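(* Let $\mathcal{H}_1,\mathcal{H}_2$ be real or complex Hilbert spaces, $M\subseteq\mathcal{H}_1$ and $N\subseteq\mathcal{H}_2$ closed subspaces, and let $T\in\mathcal{B}(\mathcal{H}_1,\mathcal{H}_2)$ have block form $T=\begin{pmatrix}A&B\\C&D\end{pmatrix}$ with respect to $\mathcal{H}_1=M\oplus M^\perp$ and $\mathcal{H}_2=N\oplus N^\perp$. Let $\lambda>0$ and assume that $T$ is $(M,N,\lambda)$-complementable. Let $Y:N^\perp\to N$ be the bounded operator such that $Y^*$ is the Douglas reduced solution of $B^*=D^*X$ (so $B=YD$). If the Schur complement $T_{/(M,N)}$ is bounded below on $M$, then $T$ is injective on $M$, and the inverse $(T|_M)^{-1}:T(M)\to M$ of the restriction of $T$ to $M$ satisfies $$\|(T|_M)^{-1}\|\le\frac{1+\|Y\|}{\gamma(T_{/(M,N)})}\le\frac{1+\lambda}{\gamma(T_{/(M,N)})}.$$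
   Context: $\mathcal{B}(\mathcal{H},\mathcal{K})$ is the space of bounded linear operators; $\mathcal{R}(\cdot)$ and $\mathcal{N}(\cdot)$ denote range and null space. Block entries: $A:M\to N$, $B:M^\perp\to N$, $C:M\to N^\perp$, $D:M^\perp\to N^\perp$, all bounded. For a closed subspace $W$, $\mathcal{B}_W=\{x\in W:\|x\|\le1\}$. For $\lambda>0$, $T$ is $(M,N,\lambda)$-complementable if $C(\mathcal{B}_M)\subseteq\lambda D(\mathcal{B}_{M^\perp})$ and $B^*(\mathcal{B}_N)\subseteq\lambda D^*(\mathcal{B}_{N^\perp})$; in particular $\mathcal{R}(C)\subseteq\mathcal{R}(D)$ and $\mathcal{R}(B^* )\subseteq\mathcal{R}(D^* )$. If $\mathcal{R}(A_1)\subseteq\mathcal{R}(B_1)$ for bounded operators $A_1,B_1$ with the same codomain, the Douglas reduced solution of $A_1=B_1X$ is the unique bounded $C_1$ with $A_1=B_1C_1$ and $\mathcal{R}(C_1)\subseteq\mathcal{N}(B_1)^\perp$. The Schur complement is $T_{/(M,N)}=\begin{pmatrix}A-BZ&0\\0&0\end{pmatrix}=\begin{pmatrix}A-YC&0\\0&0\end{pmatrix}$, where $Z$ is the Douglas reduced solution of $C=DX$ and $Y$ is as in the claim. An operator $S$ is bounded below on a subspace $W$ if there is $c>0$ with $\|Sx\|\ge c\|x\|$ for all $x\in W$. The reduced minimum modulus of $S$ is $\gamma(S)=\inf\{\|Sx\|:x\in\mathcal{N}(S)^\perp,\ \|x\|=1\}$. A vector $x\in M$ is identified with $(x,0)\in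 M\oplus M^\perp$. *)

theory Defs
  imports "HOL-Analysis.Analysis" "HOL-Library.FuncSet"
begin

text \<open>
  The scalar field is \<open>\<real>\<close> or \<open>\<complex>\<close>, both treated at once.  By the Gelfand--Mazur theorem, a
  \<^class>\<open>real_normed_field\<close> is a copy of one of the two, and the axioms below determine \<open>conjg\<close>.
\<close>

class rc_field = real_normed_field +
  fixes conjg :: "'a \<Rightarrow> 'a"
  assumes conjg_add: "conjg (x + y) = conjg x + conjg y"
    and mult_conjg_self: "x * conjg x = (norm x)\<^sup>2 *\<^sub>R 1"

instantiation real :: rc_field
begin
definition conjg_real :: "real \<Rightarrow> real" where "conjg_real x = x"
instance by standard (simp_all add: conjg_real_def power2_eq_square)
end

instantiation complex :: rc_field
begin
definition conjg_complex :: "complex \<Rightarrow> complex" where "conjg_complex = cnj"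
instance by standard (simp_all add: conjg_complex_def scaleR_conv_of_real complex_norm_square flip: of_real_power)
end

text \<open>
  Norm, topology and completeness come from the type; \<open>scl\<close> is the scalar multiplication and
  \<open>ip\<close> the inner product, linear in its first argument.
\<close>

locale hilbert_space = vector_space scl
  for scl :: "'k::rc_field \<Rightarrow> 'a::banach \<Rightarrow> 'a" +
  fixes ip :: "'a \<Rightarrow> 'a \<Rightarrow> 'k"
  assumes scl_of_real: "scl (of_real r) x = r *\<^sub>R x"
    and ip_add_left: "ip (x + y) z = ip x z + ip y z"
    and ip_scl_left: "ip (scl c x) y = c * ip x y"
    and ip_commute: "ip y x = conjg (ip x y)"
    and ip_self: "ip x x = of_real ((norm x)\<^sup>2)"

lemma hilbert_space_real:
  "hilbert_space scaleR (inner :: 'a::{real_inner, banach} \<Rightarrow> 'a \<Rightarrow> real)"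
  by unfold_locales
    (simp_all add: algebra_simps inner_commute conjg_real_def power2_norm_eq_inner)

lemma hilbert_space_complex:
  "hilbert_space (*) (\<lambda>x y :: complex. x * cnj y)"
  by unfold_locales
    (simp_all add: algebra_simps conjg_complex_def scaleR_conv_of_real complex_norm_square
      flip: of_real_power)

definition ortho :: "('a \<Rightarrow> 'a \<Rightarrow> 'k::zero) \<Rightarrow> 'a set \<Rightarrow> 'a set" where
  "ortho ip V = {x. \<forall>v\<in>V. ip v x = 0}"

definition proj :: "('a::ab_group_add \<Rightarrow> 'a \<Rightarrow> 'k::zero) \<Rightarrow> 'a set \<Rightarrow> 'a \<Rightarrow> 'a" where
  "proj ip V x = (THE p. p \<in> V \<and> x - p \<in> ortho ip V)"

definition unit_ball :: "'a::real_normed_vector set \<Rightarrow> 'a set" where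
  "unit_ball V = {x\<in>V. norm x \<le> 1}"

text \<open>
  An operator between subspaces \<open>V\<close> and \<open>W\<close> is an extensional function: it is \<open>undefined\<close> outside
  \<open>V\<close>, so equality of operators is equality of functions.
\<close>

definition bounded_ops ::
  "('k \<Rightarrow> 'a::real_normed_vector \<Rightarrow> 'a) \<Rightarrow> ('k \<Rightarrow> 'b::real_normed_vector \<Rightarrow> 'b) \<Rightarrow>
    'a set \<Rightarrow> 'b set \<Rightarrow> ('a \<Rightarrow> 'b) set" where
  "bounded_ops scl\<^sub>1 scl\<^sub>2 V W = {S \<in> V \<rightarrow>\<^sub>E W.
     (\<forall>x\<in>V. \<forall>y\<in>V. S (x + y) = S x + S y) \<and>
     (\<forall>c. \<forall>x\<in>V. S (scl\<^sub>1 c x) = scl\<^sub>2 c (S x)) \<and>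
     (\<exists>K. \<forall>x\<in>V. norm (S x) \<le> K * norm x)}"

text \<open>The adjoint \<open>W \<rightarrow> V\<close> of an operator \<open>S : V \<rightarrow> W\<close>.\<close>

definition adj ::
  "('a \<Rightarrow> 'a \<Rightarrow> 'k) \<Rightarrow> ('b \<Rightarrow> 'b \<Rightarrow> 'k) \<Rightarrow> 'a set \<Rightarrow> 'b set \<Rightarrow> ('a \<Rightarrow> 'b) \<Rightarrow> 'b \<Rightarrow> 'a" where
  "adj ip\<^sub>1 ip\<^sub>2 V W S = (\<lambda>y\<in>W. THE x. x \<in> V \<and> (\<forall>v\<in>V. ip\<^sub>2 (S v) y = ip\<^sub>1 v x))"

text \<open>
  The entry \<open>V \<rightarrow> W\<close> of the block form of \<open>T\<close>.  Writing \<open>P\<close> for the orthogonal projection, \<open>A\<close>, \<open>B\<close>,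
  \<open>C\<close>, \<open>D\<close> below are the restrictions of \<open>P\<^sub>N T\<close>, \<open>P\<^sub>N T\<close>, \<open>(1 - P\<^sub>N) T\<close>, \<open>(1 - P\<^sub>N) T\<close> to
  \<open>M\<close>, \<open>M\<^sup>\<bottom>\<close>, \<open>M\<close>, \<open>M\<^sup>\<bottom>\<close>.
\<close>

definition block ::
  "('b::ab_group_add \<Rightarrow> 'b \<Rightarrow> 'k::zero) \<Rightarrow> 'a set \<Rightarrow> 'b set \<Rightarrow> ('a \<Rightarrow> 'b) \<Rightarrow> 'a \<Rightarrow> 'b" where
  "block ip\<^sub>2 V W T = (\<lambda>x\<in>V. proj ip\<^sub>2 W (T x))"

definition complementable ::
  "('a::real_normed_vector \<Rightarrow> 'a \<Rightarrow> 'k::zero) \<Rightarrow> ('b::real_normed_vector \<Rightarrow> 'b \<Rightarrow> 'k) \<Rightarrow>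
    'a set \<Rightarrow> 'b set \<Rightarrow> real \<Rightarrow> ('a \<Rightarrow> 'b) \<Rightarrow> bool" where
  "complementable ip\<^sub>1 ip\<^sub>2 M N l T \<longleftrightarrow>
    (let M' = ortho ip\<^sub>1 M; N' = ortho ip\<^sub>2 N;
         B = block ip\<^sub>2 M' N T; C = block ip\<^sub>2 M N' T; D = block ip\<^sub>2 M' N' T
     in C ` unit_ball M \<subseteq> (*\<^sub>R) l ` D ` unit_ball M' \<and>
        adj ip\<^sub>1 ip\<^sub>2 M' N B ` unit_ball N \<subseteq>
          (*\<^sub>R) l ` adj ip\<^sub>1 ip\<^sub>2 M' N' D ` unit_ball N')"

text \<open>
  \<open>X : U \<rightarrow> V\<close> is the reduced solution of \<open>A = B X\<close>, where \<open>B\<close> is defined on \<open>V\<close> and \<open>A\<close> on \<open>U\<close>.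
  The null space of \<open>B\<close> is taken in \<open>V\<close>.
\<close>

definition douglas_reduced_solution ::
  "('k \<Rightarrow> 'u::real_normed_vector \<Rightarrow> 'u) \<Rightarrow> ('k::zero \<Rightarrow> 'v::real_normed_vector \<Rightarrow> 'v) \<Rightarrow>
    ('v \<Rightarrow> 'v \<Rightarrow> 'k) \<Rightarrow> 'u set \<Rightarrow> 'v set \<Rightarrow> ('u \<Rightarrow> 'w::zero) \<Rightarrow> ('v \<Rightarrow> 'w) \<Rightarrow> ('u \<Rightarrow> 'v) \<Rightarrow> bool"
  where
  "douglas_reduced_solution sclU sclV ipV U V A B X \<longleftrightarrow>
     X \<in> bounded_ops sclU sclV U V \<and> A = compose U B X \<and>
     X ` U \<subseteq> ortho ipV {v\<in>V. B v = 0}"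

text \<open>The Schur complement as an operator on the whole space, zero on the complement of \<open>M\<close>.\<close>

definition schur_complement ::
  "('k::zero \<Rightarrow> 'a::real_normed_vector \<Rightarrow> 'a) \<Rightarrow> ('a \<Rightarrow> 'a \<Rightarrow> 'k) \<Rightarrow>
    ('b::real_normed_vector \<Rightarrow> 'b \<Rightarrow> 'k) \<Rightarrow> 'a set \<Rightarrow> 'b set \<Rightarrow> ('a \<Rightarrow> 'b) \<Rightarrow> 'a \<Rightarrow> 'b" where
  "schur_complement scl\<^sub>1 ip\<^sub>1 ip\<^sub>2 M N T =
    (let M' = ortho ip\<^sub>1 M; N' = ortho ip\<^sub>2 N;
         A = block ip\<^sub>2 M N T; B = block ip\<^sub>2 M' N T;
         C = block ip\<^sub>2 M N' T; D = block ip\<^sub>2 M' N' T;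
         Z = (THE Z. douglas_reduced_solution scl\<^sub>1 scl\<^sub>1 ip\<^sub>1 M M' C D Z)
     in (\<lambda>x. A (proj ip\<^sub>1 M x) - B (Z (proj ip\<^sub>1 M x))))"

definition bounded_below_on ::
  "'a::real_normed_vector set \<Rightarrow> ('a \<Rightarrow> 'b::real_normed_vector) \<Rightarrow> bool" where
  "bounded_below_on W S \<longleftrightarrow> (\<exists>c>0. \<forall>x\<in>W. norm (S x) \<ge> c * norm x)"

text \<open>
  Operator norm (\<open>\<infinity>\<close> for an unbounded operator) and reduced minimum modulus take values in
  \<open>[0, \<infinity>]\<close>; in particular the reduced minimum modulus of the zero operator is \<open>inf {} = \<infinity>\<close>,
  and then a finite number divided by it is \<open>0\<close>.
\<close>

definition op_norm ::
  "'a::real_normed_vector set \<Rightarrow> ('a \<Rightarrow> 'b::real_normed_vector) \<Rightarrow> ennreal" where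
  "op_norm V S = (SUP x\<in>unit_ball V. ennreal (norm (S x)))"

definition reduced_min_modulus ::
  "('a::real_normed_vector \<Rightarrow> 'a \<Rightarrow> 'k::zero) \<Rightarrow> ('a \<Rightarrow> 'b::real_normed_vector) \<Rightarrow> ennreal" where
  "reduced_min_modulus ip S =
     (INF x\<in>{x \<in> ortho ip {v. S v = 0}. norm x = 1}. ennreal (norm (S x)))"

end

theory Submission
  imports Defs
begin

text \<open>
  Write \<open>S\<close> for the Schur complement. Since \<open>B = Y D\<close> and \<open>C = D Z\<close>, it equals
  \<open>A - B Z = A - Y C\<close> on \<open>M\<close>. Here \<open>A x\<close> and \<open>C x\<close> are the components of \<open>T x\<close> in \<open>N\<close> and
  \<open>N\<^sup>\<bottom>\<close>, both at most as long as \<open>T x\<close>, so \<open>\<parallel>S x\<parallel> \<le> (1 + \<parallel>Y\<parallel>) \<parallel>T x\<parallel>\<close> for \<open>x \<in> M\<close>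
  (\<open>norm_schur_complement_le\<close>). A lower bound for \<open>S\<close> on \<open>M\<close> is thereby a lower bound for \<open>T\<close> on
  \<open>M\<close>. As \<open>S\<close> is injective on \<open>M\<close> and zero on \<open>M\<^sup>\<bottom>\<close>, the best lower bound is \<open>\<gamma>(S)\<close>
  (\<open>reduced_min_modulus_schur_le\<close>); this gives the first inequality.

  The second one is \<open>\<parallel>Y\<parallel> \<le> l\<close>. A reduced solution picks the shortest preimage, and
  \<open>B\<^sup>*(\<B>\<^sub>N) \<subseteq> l D\<^sup>*(\<B>\<^bsub>N'\<^esub>)\<close> provides preimages of length at most \<open>l\<close>, hence \<open>\<parallel>Y\<^sup>*\<parallel> \<le> l\<close>
  (\<open>norm_reduced_solution_le\<close>), and the bound passes to \<open>Y\<close>.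

  Projections, adjoints and \<open>Z\<close> are defined by definite description, so their existence has to be
  established: from the projection theorem, the Riesz representation theorem and the Douglas
  factorization.
\<close>

section \<open>The scalar field\<close>

text \<open>
  The two axioms force \<open>conjg x = \<parallel>x\<parallel>\<^sup>2 / x\<close> for \<open>x \<noteq> 0\<close>, which makes \<open>conjg\<close> multiplicative,
  isometric and involutive.
\<close>

lemma conjg_0: "conjg (0::'k::rc_field) = 0"
  using conjg_add[of "0::'k" 0] by simp

lemma conjg_eq: "x \<noteq> 0 \<Longrightarrow> conjg x = of_real ((norm x)\<^sup>2) / x" for x :: "'k::rc_field"
  using mult_conjg_self[of x] by (simp add: of_real_def eq_divide_eq mult.commute)

lemma mult_conjg_eq_norm: "x * conjg x = of_real ((norm x)\<^sup>2)" for x :: "'k::rc_field"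
  by (simp add: mult_conjg_self of_real_def)

lemma conjg_mult: "conjg (x * y) = conjg x * conjg y" for x y :: "'k::rc_field"
  by (cases "x = 0 \<or> y = 0") (auto simp: conjg_0 conjg_eq norm_mult power_mult_distrib)

lemma conjg_of_real: "conjg (of_real r :: 'k::rc_field) = of_real r"
  by (cases "r = 0") (auto simp: conjg_0 conjg_eq power2_eq_square)

lemma norm_conjg: "norm (conjg x) = norm x" for x :: "'k::rc_field"
  by (cases "x = 0") (auto simp: conjg_0 conjg_eq norm_divide norm_mult power2_eq_square)

lemma conjg_conjg: "conjg (conjg x) = x" for x :: "'k::rc_field"
proof (cases "x = 0")
  case False
  then have "conjg x \<noteq> 0" using norm_conjg[of x] by force
  then show ?thesis using False by (simp add: conjg_eq[of "conjg x"] norm_conjg) (simp add: conjg_eq)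
qed (simp add: conjg_0)

lemma conjg_eq_0_iff: "conjg x = 0 \<longleftrightarrow> x = 0" for x :: "'k::rc_field"
  by (metis norm_conjg norm_eq_zero)

lemma conjg_uminus: "conjg (- x) = - conjg x" for x :: "'k::rc_field"
  using conjg_add[of x "- x"] by (simp add: conjg_0 minus_unique)

section \<open>Hilbert space geometry\<close>

context hilbert_space
begin

lemma ip_0_left: "ip 0 z = 0"
  using ip_add_left[of 0 0 z] by simp

lemma ip_uminus_left: "ip (- x) z = - ip x z"
  using ip_add_left[of x "- x" z] by (simp add: ip_0_left minus_unique)

lemma ip_diff_left: "ip (x - y) z = ip x z - ip y z"
  using ip_add_left[of x "- y" z] by (simp add: ip_uminus_left)

lemma ip_add_right: "ip z (x + y) = ip z x + ip z y"
  by (metis ip_commute conjg_add ip_add_left)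

lemma ip_scl_right: "ip z (scl c x) = conjg c * ip z x"
  by (metis ip_commute conjg_mult ip_scl_left)

lemma ip_0_right: "ip z 0 = 0"
  by (metis ip_commute conjg_0 ip_0_left)

lemma ip_uminus_right: "ip z (- x) = - ip z x"
  by (metis ip_commute conjg_uminus ip_uminus_left)

lemma ip_diff_right: "ip z (x - y) = ip z x - ip z y"
  using ip_add_right[of z x "- y"] by (simp add: ip_uminus_right)

lemma ip_eq_0_commute: "ip x y = 0 \<longleftrightarrow> ip y x = 0"
  by (metis ip_commute conjg_eq_0_iff)

lemma ip_self_eq_0_iff: "ip x x = 0 \<longleftrightarrow> x = 0"
  by (simp add: ip_self)

lemma norm_scl: "norm (scl c x) = norm c * norm x"
proof -
  have "(of_real ((norm (scl c x))\<^sup>2) :: 'k) = c * conjg c * ip x x"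
    by (simp add: ip_scl_left ip_scl_right mult.assoc del: of_real_power flip: ip_self)
  also have "\<dots> = of_real ((norm c * norm x)\<^sup>2)"
    by (simp only: mult_conjg_eq_norm ip_self power_mult_distrib of_real_mult)
  finally show ?thesis by (simp only: of_real_eq_iff) simp
qed

lemma pythagoras:
  assumes "ip x y = 0"
  shows "(norm (x + y))\<^sup>2 = (norm x)\<^sup>2 + (norm y)\<^sup>2"
proof -
  have "ip y x = 0" using assms by (simp add: ip_eq_0_commute)
  then have "ip (x + y) (x + y) = ip x x + ip y y"
    by (simp add: assms ip_add_left ip_add_right)
  then show ?thesis by (simp only: ip_self of_real_eq_iff flip: of_real_add)
qed

lemma parallelogram_law:
  fixes x y :: 'a
  shows
  "(norm (x + y))\<^sup>2 + (norm (x - y))\<^sup>2 = 2 * (norm x)\<^sup>2 + 2 * (norm y)\<^sup>2"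
proof -
  have "ip (x + y) (x + y) + ip (x - y) (x - y) = ip x x + ip x x + ip y y + ip y y"
    by (simp add: ip_add_left ip_add_right ip_diff_left ip_diff_right)
  then have "(norm (x + y))\<^sup>2 + (norm (x - y))\<^sup>2
      = (norm x)\<^sup>2 + (norm x)\<^sup>2 + (norm y)\<^sup>2 + (norm y)\<^sup>2"
    by (simp only: ip_self of_real_eq_iff flip: of_real_add)
  then show ?thesis by simp
qed

text \<open>
  Pythagoras for the splitting of \<open>x\<close> into its component along \<open>y\<close> and the rest.  Dropping the first
  summand gives Cauchy--Schwarz; minimality of \<open>\<parallel>x\<parallel>\<close> among the \<open>\<parallel>x - c y\<parallel>\<close> gives orthogonality
  of \<open>x\<close> and \<open>y\<close>.
\<close>

lemma norm_split_along:
  assumes "y \<noteq> 0"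
  shows "(norm x)\<^sup>2 = (norm (x - scl (ip x y / of_real ((norm y)\<^sup>2)) y))\<^sup>2
    + (norm (ip x y) / norm y)\<^sup>2"
proof -
  define c where "c = ip x y / of_real ((norm y)\<^sup>2)"
  have "ip (x - scl c y) y = 0"
    using assms by (simp add: ip_diff_left ip_scl_left ip_self c_def)
  then have "ip (x - scl c y) (scl c y) = 0" by (simp add: ip_scl_right)
  from pythagoras[OF this]
  have "(norm x)\<^sup>2 = (norm (x - scl c y))\<^sup>2 + (norm (scl c y))\<^sup>2" by simp
  moreover have "norm (scl c y) = norm (ip x y) / norm y"
    using assms by (simp add: norm_scl c_def norm_divide norm_mult power2_eq_square)
  ultimately show ?thesis by (simp add: c_def)
qed

lemma Cauchy_Schwarz: "norm (ip x y) \<le> norm x * norm y"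
proof (cases "y = 0")
  case False
  have "(norm (ip x y) / norm y)\<^sup>2 \<le> (norm x)\<^sup>2"
    using norm_split_along[OF False, of x] by simp
  then have "norm (ip x y) / norm y \<le> norm x" by (rule power2_le_imp_le) simp
  then show ?thesis using False by (simp add: divide_le_eq)
qed (simp add: ip_0_right)

lemma subspace_scaleR: "subspace V \<Longrightarrow> x \<in> V \<Longrightarrow> r *\<^sub>R x \<in> V"
  using subspace_scale[of V x "of_real r"] by (simp add: scl_of_real)

lemma subspace_ortho: "subspace (ortho ip V)"
  by (auto intro!: subspaceI simp: ortho_def ip_0_right ip_add_right ip_scl_right)

lemma closed_kernel:
  fixes f :: "'a \<Rightarrow> 'c::real_normed_vector"
  assumes V: "subspace V" "closed V"
    and add: "\<And>x y. x \<in> V \<Longrightarrow> y \<in> V \<Longrightarrow> f (x + y) = f x + f y"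
    and bound: "\<And>x. x \<in> V \<Longrightarrow> norm (f x) \<le> K * norm x"
  shows "closed {x \<in> V. f x = 0}"
proof -
  have "\<bar>K\<bar>-lipschitz_on V f"
  proof (rule lipschitz_onI)
    fix x y assume xy: "x \<in> V" "y \<in> V"
    then have d: "x - y \<in> V" using V by (simp add: subspace_diff)
    have "norm (f x - f y) = norm (f (x - y))" using add[OF d xy(2)] by simp
    also have "\<dots> \<le> K * norm (x - y)" by (rule bound[OF d])
    also have "\<dots> \<le> \<bar>K\<bar> * norm (x - y)" by (simp add: mult_right_mono)
    finally show "dist (f x) (f y) \<le> \<bar>K\<bar> * dist x y" by (simp add: dist_norm)
  qed simp
  then show ?thesis
    using V(2) by (intro continuous_closed_preimage_constant lipschitz_on_continuous_on)
qed

lemma closed_ortho: "closed (ortho ip V)"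
proof -
  have "closed {x \<in> UNIV. ip x v = 0}" for v
    by (rule closed_kernel[where K = "norm v"])
      (auto simp: ip_add_left mult.commute[of "norm v"] intro: Cauchy_Schwarz)
  moreover have "ortho ip V = (\<Inter>v\<in>V. {x \<in> UNIV. ip x v = 0})"
    by (auto simp: ortho_def ip_eq_0_commute)
  ultimately show ?thesis by auto
qed

lemma ortho_disjoint: "x \<in> V \<Longrightarrow> x \<in> ortho ip V \<Longrightarrow> x = 0"
  by (auto simp: ortho_def ip_self_eq_0_iff)

text \<open>
  The points of \<open>V\<close> whose squared distance to \<open>x\<close> exceeds the infimum by at most \<open>1 / (n + 1)\<close> form
  nested closed sets, whose diameters shrink to \<open>0\<close> by the parallelogram law; their common point is
  the nearest point of \<open>V\<close>.
\<close>

lemma projection_exists: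
  assumes V: "subspace V" "closed V"
  shows "\<exists>p\<in>V. x - p \<in> ortho ip V"
proof -
  let ?q = "\<lambda>p. (norm (x - p))\<^sup>2"
  define d where "d = (INF p\<in>V. ?q p)"
  have bdd: "bdd_below (?q ` V)" by (rule bdd_belowI[of _ 0]) auto
  have ne: "V \<noteq> {}" using subspace_0[OF V(1)] by auto
  have d_le: "d \<le> ?q p" if "p \<in> V" for p
    unfolding d_def by (rule cINF_lower[OF bdd that])
  define F where "F n = {p \<in> V. ?q p \<le> d + 1 / real (Suc n)}" for n
  have "\<exists>p. \<forall>n. p \<in> F n"
  proof (rule decreasing_closed_nest)
    show "closed (F n)" for n
    proof -
      have "F n = V \<inter> {p. ?q p \<le> d + 1 / real (Suc n)}" by (auto simp: F_def)
      moreover have "closed {p. ?q p \<le> d + 1 / real (Suc n)}"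
        by (intro closed_Collect_le continuous_intros)
      ultimately show ?thesis using V(2) by (simp add: closed_Int)
    qed
    show "F n \<noteq> {}" for n
    proof -
      have "(INF p\<in>V. ?q p) < d + 1 / real (Suc n)" by (simp add: d_def)
      then obtain p where "p \<in> V" "?q p < d + 1 / real (Suc n)"
        using cINF_less_iff[OF ne bdd] by blast
      then have "p \<in> F n" by (simp add: F_def)
      then show ?thesis by blast
    qed
    show "F n \<subseteq> F m" if "m \<le> n" for m n
    proof -
      have "1 / real (Suc n) \<le> 1 / real (Suc m)" using that by (simp add: frac_le)
      then show ?thesis unfolding F_def by (smt (verit) mem_Collect_eq subsetI)
    qed
    fix e :: real assume e: "e > 0"
    then have "e\<^sup>2 / 4 > 0" by simp
    then obtain n where n: "1 / real (Suc n) < e\<^sup>2 / 4"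
      using reals_Archimedean[of "e\<^sup>2 / 4"] unfolding inverse_eq_divide by blast
    have "dist p q < e" if pq: "p \<in> F n" "q \<in> F n" for p q
    proof -
      let ?m = "(1 / 2) *\<^sub>R (p + q)"
      have "?m \<in> V" using pq V by (intro subspace_scaleR subspace_add) (auto simp: F_def)
      then have "d \<le> ?q ?m" by (rule d_le)
      moreover have "(x - p) + (x - q) = 2 *\<^sub>R (x - ?m)"
        by (simp add: scaleR_right_diff_distrib scaleR_2)
      then have "(norm ((x - p) + (x - q)))\<^sup>2 = 4 * ?q ?m"
        by (simp add: power_mult_distrib)
      moreover have "norm ((x - p) - (x - q)) = dist p q"
        by (simp add: dist_norm norm_minus_commute)
      ultimately have "(dist p q)\<^sup>2 \<le> 2 * ?q p + 2 * ?q q - 4 * d"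
        using parallelogram_law[of "x - p" "x - q"] by simp
      also have "\<dots> < e\<^sup>2" using pq n by (simp add: F_def)
      finally show ?thesis using e by (simp add: power2_less_imp_less)
    qed
    then show "\<exists>n. \<forall>p\<in>F n. \<forall>q\<in>F n. dist p q < e" by blast
  qed blast
  then obtain p where p: "\<And>n. p \<in> F n" by blast
  then have pV: "p \<in> V" by (auto simp: F_def)
  have pd: "?q p \<le> d"
  proof (rule field_le_epsilon)
    fix e :: real assume "e > 0"
    then obtain n where "1 / real (Suc n) < e"
      using reals_Archimedean by (auto simp: inverse_eq_divide)
    then show "?q p \<le> d + e" using p[of n] by (simp add: F_def)
  qed
  have "ip (x - p) v = 0" if v: "v \<in> V" for v
  proof (cases "v = 0")
    case False
    let ?c = "ip (x - p) v / of_real ((norm v)\<^sup>2)"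
    have "p + scl ?c v \<in> V" using pV v V by (intro subspace_add subspace_scale)
    then have "?q p \<le> ?q (p + scl ?c v)" using pd d_le by (blast intro: order_trans)
    then have "(norm (x - p))\<^sup>2 \<le> (norm (x - p - scl ?c v))\<^sup>2" by (simp only: diff_diff_eq)
    then have "(norm (ip (x - p) v) / norm v)\<^sup>2 \<le> 0"
      using norm_split_along[OF False, of "x - p"] by linarith
    then show ?thesis using False by simp
  qed (simp add: ip_0_right)
  then have "x - p \<in> ortho ip V" by (auto simp: ortho_def ip_eq_0_commute)
  then show ?thesis using pV by blast
qed

lemma proj_eqI:
  assumes "subspace V" "p \<in> V" "x - p \<in> ortho ip V"
  shows "proj ip V x = p"
  unfolding proj_def
proof (rule the_equality)
  fix q assume q: "q \<in> V \<and> x - q \<in> ortho ip V"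
  have "p - q = (x - q) - (x - p)" by simp
  then have "p - q \<in> ortho ip V"
    using q assms(3) subspace_diff[OF subspace_ortho] by metis
  moreover have "p - q \<in> V" using q assms by (simp add: subspace_diff)
  ultimately show "q = p" using ortho_disjoint by force
qed (use assms in auto)

lemma proj_props:
  assumes "subspace V" "closed V"
  shows "proj ip V x \<in> V" and "x - proj ip V x \<in> ortho ip V"
  using projection_exists[OF assms, of x] proj_eqI[OF assms(1)] by auto

lemma proj_add:
  assumes V: "subspace V" "closed V"
  shows "proj ip V (x + y) = proj ip V x + proj ip V y"
proof (rule proj_eqI[OF V(1)])
  have "(x - proj ip V x) + (y - proj ip V y) \<in> ortho ip V"
    by (intro subspace_add subspace_ortho proj_props V)
  then show "x + y - (proj ip V x + proj ip V y) \<in> ortho ip V" by (simp add: algebra_simps)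
qed (intro subspace_add proj_props V)

lemma proj_scl:
  assumes V: "subspace V" "closed V"
  shows "proj ip V (scl c x) = scl c (proj ip V x)"
proof (rule proj_eqI[OF V(1)])
  have "scl c (x - proj ip V x) \<in> ortho ip V"
    by (intro subspace_scale subspace_ortho proj_props V)
  then show "scl c x - scl c (proj ip V x) \<in> ortho ip V" by (simp add: scale_right_diff_distrib)
qed (intro subspace_scale proj_props V)

lemma norm_add_ortho_ge:
  assumes "ip x y = 0"
  shows "norm x \<le> norm (x + y)"
proof (rule power2_le_imp_le)
  show "(norm x)\<^sup>2 \<le> (norm (x + y))\<^sup>2" using pythagoras[OF assms] by simp
qed simp

lemma norm_proj_le:
  assumes V: "subspace V" "closed V"
  shows "norm (proj ip V x) \<le> norm x"
  using norm_add_ortho_ge[of "proj ip V x" "x - proj ip V x"] proj_props[OF V, of x]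
  by (auto simp: ortho_def)

text \<open>
  Unless \<open>f\<close> vanishes on \<open>V\<close>, its kernel has a nonzero normal vector \<open>w \<in> V\<close>; as the kernel has
  codimension one, a scalar multiple of \<open>w\<close> represents \<open>f\<close>.
\<close>

lemma Riesz_representation:
  fixes f :: "'a \<Rightarrow> 'k"
  assumes V: "subspace V" "closed V"
    and add: "\<And>x y. x \<in> V \<Longrightarrow> y \<in> V \<Longrightarrow> f (x + y) = f x + f y"
    and hom: "\<And>c x. x \<in> V \<Longrightarrow> f (scl c x) = c * f x"
    and bound: "\<And>x. x \<in> V \<Longrightarrow> norm (f x) \<le> K * norm x"
  shows "\<exists>!x. x \<in> V \<and> (\<forall>v\<in>V. f v = ip v x)"
proof (rule ex_ex1I)
  show "\<exists>x. x \<in> V \<and> (\<forall>v\<in>V. f v = ip v x)"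
  proof (cases "\<forall>v\<in>V. f v = 0")
    case True
    then show ?thesis using V by (intro exI[of _ 0]) (simp add: subspace_0 ip_0_right)
  next
    case False
    then obtain u where u: "u \<in> V" "f u \<noteq> 0" by blast
    define K where "K = {v \<in> V. f v = 0}"
    have f0: "f 0 = 0" using hom[of 0 0] V(1) by (simp add: subspace_0)
    have K: "subspace K" "closed K"
      unfolding K_def
      using V(1) f0 add hom
      by (auto intro!: subspaceI closed_kernel[OF V add bound]
          simp: subspace_0 subspace_add subspace_scale)
    define w where "w = u - proj ip K u"
    have p: "proj ip K u \<in> V" "f (proj ip K u) = 0" using proj_props(1)[OF K, of u] by (auto simp: K_def)
    have w: "w \<in> V" "w \<in> ortho ip K"
      using u p V proj_props(2)[OF K, of u] by (auto simp: w_def subspace_diff)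
    have fw: "f w \<noteq> 0" using add[OF w(1) p(1)] p(2) u(2) by (simp add: w_def)
    then have w0: "w \<noteq> 0" using f0 by auto
    define x where "x = scl (conjg (f w) / of_real ((norm w)\<^sup>2)) w"
    have "f v = ip v x" if v: "v \<in> V" for v
    proof -
      let ?t = "f v / f w"
      have vt: "v - scl ?t w \<in> V" using v w V by (simp add: subspace_diff subspace_scale)
      have "f v = f (v - scl ?t w) + ?t * f w"
        using add[OF vt subspace_scale[OF V(1) w(1)], of ?t] hom[OF w(1), of ?t] by simp
      then have "v - scl ?t w \<in> K" using vt fw by (simp add: K_def)
      then have "ip (v - scl ?t w) w = 0" using w(2) by (auto simp: ortho_def)
      then have "ip v w = ?t * of_real ((norm w)\<^sup>2)" by (simp add: ip_diff_left ip_scl_left ip_self)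
      moreover have "conjg (conjg (f w) / of_real ((norm w)\<^sup>2)) = f w / of_real ((norm w)\<^sup>2)"
        by (simp only: divide_inverse conjg_mult conjg_conjg conjg_of_real flip: of_real_inverse)
      ultimately show ?thesis using fw w0 by (simp add: x_def ip_scl_right)
    qed
    moreover have "x \<in> V" using w V by (simp add: x_def subspace_scale)
    ultimately show ?thesis by blast
  qed
next
  fix x y assume "x \<in> V \<and> (\<forall>v\<in>V. f v = ip v x)" and "y \<in> V \<and> (\<forall>v\<in>V. f v = ip v y)"
  then have "x - y \<in> V" "x - y \<in> ortho ip V"
    using V by (auto simp: subspace_diff ortho_def ip_diff_right)
  then show "x = y" using ortho_disjoint by fastforce
qed

end

section \<open>Operators between subspaces\<close>

lemma bounded_opsD:
  assumes "S \<in> bounded_ops scl\<^sub>1 scl\<^sub>2 V W"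
  shows "x \<in> V \<Longrightarrow> S x \<in> W"
    and "x \<in> V \<Longrightarrow> y \<in> V \<Longrightarrow> S (x + y) = S x + S y"
    and "x \<in> V \<Longrightarrow> S (scl\<^sub>1 c x) = scl\<^sub>2 c (S x)"
    and "S \<in> extensional V"
  using assms by (auto simp: bounded_ops_def PiE_iff)

lemma bounded_ops_bound:
  assumes "S \<in> bounded_ops scl\<^sub>1 scl\<^sub>2 V W"
  shows "\<exists>K\<ge>0. \<forall>x\<in>V. norm (S x) \<le> K * norm x"
proof -
  obtain K where K: "\<And>x. x \<in> V \<Longrightarrow> norm (S x) \<le> K * norm x"
    using assms unfolding bounded_ops_def by blast
  have "norm (S x) \<le> \<bar>K\<bar> * norm x" if "x \<in> V" for x
    using K[OF that] by (rule order_trans) (simp add: mult_right_mono)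
  then show ?thesis by (intro exI[of _ "\<bar>K\<bar>"]) auto
qed

context hilbert_space
begin

lemma bounded_ops_0:
  assumes "S \<in> bounded_ops scl sclW V W" "subspace V"
  shows "S 0 = 0"
  using bounded_opsD(2)[OF assms(1), of 0 0] subspace_0[OF assms(2)] by simp

lemma bounded_ops_diff:
  assumes "S \<in> bounded_ops scl sclW V W" "subspace V" "x \<in> V" "y \<in> V"
  shows "S (x - y) = S x - S y"
  using bounded_opsD(2)[OF assms(1) subspace_diff[OF assms(2-4)] assms(4)] by simp

lemma null_space:
  assumes S: "S \<in> bounded_ops scl sclW V W" and V: "subspace V" "closed V"
  shows "subspace {v \<in> V. S v = 0}" and "closed {v \<in> V. S v = 0}"
proof -
  note S0 = bounded_ops_0[OF S V(1)]
  have "sclW c 0 = 0" for c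
    using bounded_opsD(3)[OF S subspace_0[OF V(1)], of c] S0 by simp
  then show "subspace {v \<in> V. S v = 0}"
    using V(1) S0 bounded_opsD(2,3)[OF S]
    by (auto intro!: subspaceI simp: subspace_0 subspace_add subspace_scale)
  obtain K where "\<And>x. x \<in> V \<Longrightarrow> norm (S x) \<le> K * norm x"
    using bounded_ops_bound[OF S] by auto
  with bounded_opsD(2)[OF S] show "closed {v \<in> V. S v = 0}"
    by (intro closed_kernel[OF V])
qed

end

lemma bounded_ops_scaleR:
  assumes "hilbert_space scl\<^sub>1 ip\<^sub>1" "hilbert_space scl\<^sub>2 ip\<^sub>2"
    and "S \<in> bounded_ops scl\<^sub>1 scl\<^sub>2 V W" "x \<in> V"
  shows "S (r *\<^sub>R x) = r *\<^sub>R S x"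
  using bounded_opsD(3)[OF assms(3,4), of "of_real r"] assms(1,2)
  by (simp add: hilbert_space.scl_of_real)

lemma op_norm_bound:
  assumes "hilbert_space scl\<^sub>1 ip\<^sub>1" "hilbert_space scl\<^sub>2 ip\<^sub>2"
    and S: "S \<in> bounded_ops scl\<^sub>1 scl\<^sub>2 V W" and V: "module.subspace scl\<^sub>1 V" and x: "x \<in> V"
  shows "ennreal (norm (S x)) \<le> op_norm V S * ennreal (norm x)"
proof (cases "x = 0")
  case True
  interpret H1: hilbert_space scl\<^sub>1 ip\<^sub>1 by fact
  show ?thesis using H1.bounded_ops_0[OF S V] True by simp
next
  case False
  interpret H1: hilbert_space scl\<^sub>1 ip\<^sub>1 by fact
  let ?u = "(1 / norm x) *\<^sub>R x"
  have "?u \<in> unit_ball V" using False x V by (simp add: unit_ball_def H1.subspace_scaleR)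
  then have "ennreal (norm (S ?u)) \<le> op_norm V S"
    unfolding op_norm_def by (rule SUP_upper)
  then have "ennreal (norm (S ?u)) * ennreal (norm x) \<le> op_norm V S * ennreal (norm x)"
    by (rule mult_right_mono) simp
  moreover have "norm (S ?u) * norm x = norm (S x)"
    using False by (simp add: bounded_ops_scaleR[OF assms(1-3) x])
  ultimately show ?thesis by (simp flip: ennreal_mult)
qed

locale hilbert_space_pair =
  H1: hilbert_space scl\<^sub>1 ip\<^sub>1 + H2: hilbert_space scl\<^sub>2 ip\<^sub>2
  for scl\<^sub>1 :: "'k::rc_field \<Rightarrow> 'a::banach \<Rightarrow> 'a" and ip\<^sub>1 :: "'a \<Rightarrow> 'a \<Rightarrow> 'k"
    and scl\<^sub>2 :: "'k \<Rightarrow> 'b::banach \<Rightarrow> 'b" and ip\<^sub>2 :: "'b \<Rightarrow> 'b \<Rightarrow> 'k"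
begin

lemma adj_props:
  assumes S: "S \<in> bounded_ops scl\<^sub>1 scl\<^sub>2 V W" and V: "H1.subspace V" "closed V" and y: "y \<in> W"
  shows "adj ip\<^sub>1 ip\<^sub>2 V W S y \<in> V" (is ?in)
    and "v \<in> V \<Longrightarrow> ip\<^sub>2 (S v) y = ip\<^sub>1 v (adj ip\<^sub>1 ip\<^sub>2 V W S y)" (is "_ \<Longrightarrow> ?eq v")
proof -
  obtain K where K: "\<And>x. x \<in> V \<Longrightarrow> norm (S x) \<le> K * norm x"
    using bounded_ops_bound[OF S] by auto
  have ex1: "\<exists>!x. x \<in> V \<and> (\<forall>v\<in>V. ip\<^sub>2 (S v) y = ip\<^sub>1 v x)"
  proof (rule H1.Riesz_representation[OF V, where K = "K * norm y"])
    fix x assume "x \<in> V"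
    have "norm (ip\<^sub>2 (S x) y) \<le> norm (S x) * norm y" by (rule H2.Cauchy_Schwarz)
    also have "\<dots> \<le> K * norm x * norm y" using K[OF \<open>x \<in> V\<close>] by (simp add: mult_right_mono)
    finally show "norm (ip\<^sub>2 (S x) y) \<le> K * norm y * norm x" by (simp add: ac_simps)
  qed (simp_all add: bounded_opsD[OF S] H2.ip_add_left H2.ip_scl_left)
  have the_adj: "adj ip\<^sub>1 ip\<^sub>2 V W S y = (THE x. x \<in> V \<and> (\<forall>v\<in>V. ip\<^sub>2 (S v) y = ip\<^sub>1 v x))"
    using y by (simp add: adj_def)
  have "?in \<and> (\<forall>v\<in>V. ?eq v)" unfolding the_adj by (rule theI'[OF ex1])
  then show ?in and "v \<in> V \<Longrightarrow> ?eq v" by auto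
qed

lemma adj_eqI:
  assumes S: "S \<in> bounded_ops scl\<^sub>1 scl\<^sub>2 V W" and V: "H1.subspace V" "closed V" and y: "y \<in> W"
    and x: "x \<in> V" "\<And>v. v \<in> V \<Longrightarrow> ip\<^sub>2 (S v) y = ip\<^sub>1 v x"
  shows "adj ip\<^sub>1 ip\<^sub>2 V W S y = x"
proof -
  let ?a = "adj ip\<^sub>1 ip\<^sub>2 V W S y"
  have "?a - x \<in> V" "?a - x \<in> ortho ip\<^sub>1 V"
    using adj_props[OF S V y] x V(1) by (auto simp: H1.subspace_diff ortho_def H1.ip_diff_right)
  then show ?thesis using H1.ortho_disjoint by fastforce
qed

lemma adj_bounded_ops:
  assumes S: "S \<in> bounded_ops scl\<^sub>1 scl\<^sub>2 V W" and V: "H1.subspace V" "closed V"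
    and W: "H2.subspace W"
  shows "adj ip\<^sub>1 ip\<^sub>2 V W S \<in> bounded_ops scl\<^sub>2 scl\<^sub>1 W V"
proof -
  let ?a = "adj ip\<^sub>1 ip\<^sub>2 V W S"
  note props = adj_props[OF S V]
  obtain K where K: "K \<ge> 0" "\<And>x. x \<in> V \<Longrightarrow> norm (S x) \<le> K * norm x"
    using bounded_ops_bound[OF S] by auto
  have "?a (x + y) = ?a x + ?a y" if "x \<in> W" "y \<in> W" for x y
    using that props V W
    by (intro adj_eqI[OF S V])
      (auto simp: H1.subspace_add H2.subspace_add H1.ip_add_right H2.ip_add_right)
  moreover have "?a (scl\<^sub>2 c x) = scl\<^sub>1 c (?a x)" if "x \<in> W" for c x
    using that props V W
    by (intro adj_eqI[OF S V])
      (auto simp: H1.subspace_scale H2.subspace_scale H1.ip_scl_right H2.ip_scl_right)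
  moreover have "norm (?a y) \<le> K * norm y" if y: "y \<in> W" for y
  proof (cases "?a y = 0")
    case False
    have "norm (?a y) * norm (?a y) = norm (ip\<^sub>2 (S (?a y)) y)"
      by (simp add: props(2)[OF y props(1)[OF y]] H1.ip_self norm_mult power2_eq_square)
    also have "\<dots> \<le> norm (S (?a y)) * norm y" by (rule H2.Cauchy_Schwarz)
    also have "\<dots> \<le> K * norm (?a y) * norm y" using K(2)[OF props(1)[OF y]] by (simp add: mult_right_mono)
    finally show ?thesis using False by (simp add: mult.assoc mult.left_commute[of K])
  qed (use K in simp)
  moreover have "?a \<in> extensional W" by (simp add: adj_def)
  ultimately show ?thesis
    using props(1) unfolding bounded_ops_def PiE_iff by blast
qed

lemma block_bounded_ops:
  assumes T: "T \<in> bounded_ops scl\<^sub>1 scl\<^sub>2 UNIV UNIV"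
    and V: "H1.subspace V" and W: "H2.subspace W" "closed W"
  shows "block ip\<^sub>2 V W T \<in> bounded_ops scl\<^sub>1 scl\<^sub>2 V W"
proof -
  obtain K where K: "\<And>x. norm (T x) \<le> K * norm x" using bounded_ops_bound[OF T] by auto
  let ?S = "block ip\<^sub>2 V W T"
  have S: "?S x = proj ip\<^sub>2 W (T x)" if "x \<in> V" for x using that by (simp add: block_def)
  have "?S x \<in> W" if "x \<in> V" for x using that H2.proj_props(1)[OF W] by (simp add: S)
  moreover have "?S (x + y) = ?S x + ?S y" if "x \<in> V" "y \<in> V" for x y
    using that V by (simp add: S H1.subspace_add bounded_opsD(2)[OF T] H2.proj_add[OF W])
  moreover have "?S (scl\<^sub>1 c x) = scl\<^sub>2 c (?S x)" if "x \<in> V" for c x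
    using that V by (simp add: S H1.subspace_scale bounded_opsD(3)[OF T] H2.proj_scl[OF W])
  moreover have "norm (?S x) \<le> K * norm x" if "x \<in> V" for x
    using that H2.norm_proj_le[OF W] K by (auto simp: S intro: order_trans)
  moreover have "?S \<in> extensional V" by (simp add: block_def)
  ultimately show ?thesis unfolding bounded_ops_def PiE_iff by blast
qed

end

section \<open>Douglas reduced solutions\<close>

lemma reduced_solutionD:
  assumes X: "douglas_reduced_solution sclU sclV ipV U V A B X" and u: "u \<in> U"
  shows "X u \<in> V" and "X u \<in> ortho ipV {v \<in> V. B v = 0}" and "B (X u) = A u"
proof -
  have "X \<in> bounded_ops sclU sclV U V" and A: "A = compose U B X"
    and "X ` U \<subseteq> ortho ipV {v \<in> V. B v = 0}"
    using X unfolding douglas_reduced_solution_def by blast+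
  then show "X u \<in> V" and "X u \<in> ortho ipV {v \<in> V. B v = 0}"
    using u bounded_opsD(1) by blast+
  show "B (X u) = A u" unfolding A by (simp add: compose_eq u)
qed

text \<open>
  The Douglas factorization in the form in which complementability states it: an inclusion of images
  of unit balls instead of an inclusion of ranges, so that the constant \<open>l\<close> bounds the solution.
  The equations \<open>C = D Z\<close> and \<open>B\<^sup>* = D\<^sup>* Y\<^sup>*\<close> are both instances.
\<close>

locale range_majorization =
  U: hilbert_space sclU ipU + V: hilbert_space sclV ipV + W: hilbert_space sclW ipW
  for sclU :: "'k::rc_field \<Rightarrow> 'u::banach \<Rightarrow> 'u" and ipU
    and sclV :: "'k \<Rightarrow> 'v::banach \<Rightarrow> 'v" and ipV
    and sclW :: "'k \<Rightarrow> 'w::banach \<Rightarrow> 'w" and ipW +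
  fixes U :: "'u set" and V :: "'v set" and W :: "'w set"
    and A :: "'u \<Rightarrow> 'w" and B :: "'v \<Rightarrow> 'w" and l :: real
  assumes U: "U.subspace U" and V: "V.subspace V" "closed V"
    and A: "A \<in> bounded_ops sclU sclW U W" and B: "B \<in> bounded_ops sclV sclW V W"
    and pos: "l > 0"
    and majorization: "A ` unit_ball U \<subseteq> (*\<^sub>R) l ` B ` unit_ball V"
begin

lemma solution_at_point:
  assumes u: "u \<in> U"
  shows "\<exists>v\<in>V. norm v \<le> l * norm u \<and> B v = A u"
proof (cases "u = 0")
  case True
  then show ?thesis using V by (intro bexI[of _ 0])
      (auto simp: U.bounded_ops_0[OF A U] V.bounded_ops_0[OF B] V.subspace_0)
next
  case False
  then have "(1 / norm u) *\<^sub>R u \<in> unit_ball U"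
    using u U by (simp add: unit_ball_def U.subspace_scaleR)
  then have "A ((1 / norm u) *\<^sub>R u) \<in> (*\<^sub>R) l ` B ` unit_ball V" using majorization by blast
  then obtain z where z: "z \<in> V" "norm z \<le> 1" "A ((1 / norm u) *\<^sub>R u) = l *\<^sub>R B z"
    by (auto simp: unit_ball_def)
  let ?v = "(norm u * l) *\<^sub>R z"
  have "A u = norm u *\<^sub>R A ((1 / norm u) *\<^sub>R u)"
    using False by (simp add: bounded_ops_scaleR[OF U.hilbert_space_axioms W.hilbert_space_axioms A u])
  then have "B ?v = A u"
    by (simp add: z(3) bounded_ops_scaleR[OF V.hilbert_space_axioms W.hilbert_space_axioms B z(1)])
  moreover have "norm ?v \<le> l * norm u"
    using z(2) pos by (simp add: abs_mult mult_left_le mult.commute[of l])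
  ultimately show ?thesis using V z by (blast intro: V.subspace_scaleR)
qed

text \<open>
  The value \<open>X u\<close> of a reduced solution is the shortest solution \<open>v\<close> of \<open>B v = A u\<close>, because it is
  orthogonal to the null space of \<open>B\<close>.
\<close>

lemma norm_reduced_solution_le:
  assumes X: "douglas_reduced_solution sclU sclV ipV U V A B X" and u: "u \<in> U"
  shows "norm (X u) \<le> l * norm u"
proof -
  obtain v where v: "v \<in> V" "norm v \<le> l * norm u" "B v = A u"
    using solution_at_point[OF u] by blast
  note Xu = reduced_solutionD[OF X u]
  have "v - X u \<in> {v \<in> V. B v = 0}"
    using v Xu V by (simp add: V.bounded_ops_diff[OF B] V.subspace_diff)
  then have "ipV (X u) (v - X u) = 0" using Xu by (auto simp: ortho_def V.ip_eq_0_commute)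
  from V.norm_add_ortho_ge[OF this] show ?thesis using v(2) by simp
qed

text \<open>
  Orthogonality to the null space of \<open>B\<close> singles out one solution \<open>v\<close> of \<open>B v = A u\<close> for each \<open>u\<close>.
  This uniqueness makes \<open>u \<mapsto> v\<close> linear, and boundedness comes from the majorization.
\<close>

lemma reduced_solution_ex1: "\<exists>!X. douglas_reduced_solution sclU sclV ipV U V A B X"
proof -
  let ?K = "{v \<in> V. B v = 0}"
  note K = V.null_space[OF B V]
  let ?P = "\<lambda>u v. v \<in> V \<and> v \<in> ortho ipV ?K \<and> B v = A u"
  have unique: "v = v'" if "?P u v" "?P u v'" for u v v'
  proof -
    have "v - v' \<in> ?K" "v - v' \<in> ortho ipV ?K"
      using that V by (auto simp: V.bounded_ops_diff[OF B] V.subspace_diff V.subspace_ortho)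
    from V.ortho_disjoint[OF this] show ?thesis by simp
  qed
  have exists: "\<exists>v. ?P u v \<and> norm v \<le> l * norm u" if u: "u \<in> U" for u
  proof -
    obtain v where v: "v \<in> V" "norm v \<le> l * norm u" "B v = A u"
      using solution_at_point[OF u] by blast
    \<comment> \<open>Removing the component in the null space of \<open>B\<close> keeps the image and shortens the vector.\<close>
    let ?p = "proj ipV ?K v"
    have p: "?p \<in> ?K" "v - ?p \<in> ortho ipV ?K" by (rule V.proj_props[OF K])+
    then have P: "?P u (v - ?p)"
      using v V by (simp add: V.bounded_ops_diff[OF B] V.subspace_diff)
    have "ipV (v - ?p) ?p = 0" using p by (auto simp: ortho_def V.ip_eq_0_commute)
    from V.norm_add_ortho_ge[OF this] have "norm (v - ?p) \<le> norm v" by simp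
    then show ?thesis using P v(2) by (intro exI[of _ "v - ?p"]) simp
  qed
  define X where "X = (\<lambda>u\<in>U. SOME v. ?P u v \<and> norm v \<le> l * norm u)"
  have bX: "X \<in> extensional U" by (simp add: X_def)
  have X: "?P u (X u)" "norm (X u) \<le> l * norm u" if "u \<in> U" for u
    using someI_ex[OF exists[OF that]] that by (auto simp: X_def)
  have "X (x + y) = X x + X y" if "x \<in> U" "y \<in> U" for x y
  proof (rule unique[of _ "x + y"])
    show "?P (x + y) (X x + X y)"
      using that X(1) V
      by (auto simp: V.subspace_add V.subspace_ortho bounded_opsD(2)[OF A] bounded_opsD(2)[OF B])
  qed (use that X(1)[of "x + y"] U in \<open>simp add: U.subspace_add\<close>)
  moreover have "X (sclU c x) = sclV c (X x)" if "x \<in> U" for c x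
  proof (rule unique[of _ "sclU c x"])
    show "?P (sclU c x) (sclV c (X x))"
      using that X(1) V
      by (auto simp: V.subspace_scale V.subspace_ortho bounded_opsD(3)[OF A] bounded_opsD(3)[OF B])
  qed (use that X(1)[of "sclU c x"] U in \<open>simp add: U.subspace_scale\<close>)
  moreover have "X u \<in> V" if "u \<in> U" for u using X(1)[OF that] by simp
  ultimately have "X \<in> bounded_ops sclU sclV U V"
    using X(2) bX unfolding bounded_ops_def PiE_iff by blast
  moreover have "A = compose U B X"
    using X(1) by (intro extensionalityI[OF bounded_opsD(4)[OF A]]) (auto simp: compose_eq)
  ultimately have "douglas_reduced_solution sclU sclV ipV U V A B X"
    using X(1) by (auto simp: douglas_reduced_solution_def)
  moreover have "X1 = X2"
    if X1: "douglas_reduced_solution sclU sclV ipV U V A B X1"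
      and X2: "douglas_reduced_solution sclU sclV ipV U V A B X2" for X1 X2
  proof -
    have b1: "X1 \<in> bounded_ops sclU sclV U V" and b2: "X2 \<in> bounded_ops sclU sclV U V"
      using X1 X2 by (auto simp: douglas_reduced_solution_def)
    show ?thesis
      by (rule extensionalityI[OF bounded_opsD(4)[OF b1] bounded_opsD(4)[OF b2]])
        (use reduced_solutionD[OF X1] reduced_solutionD[OF X2] in \<open>blast intro: unique\<close>)
  qed
  ultimately show ?thesis by blast
qed

end

section \<open>The Schur complement\<close>

text \<open>
  The two halves of complementability are range majorizations, one for the pair \<open>C\<close>, \<open>D\<close> and one
  for \<open>B\<^sup>*\<close>, \<open>D\<^sup>*\<close>; the locale instances \<open>primal\<close> and \<open>dual\<close> supply \<open>Z\<close> and the bound on \<open>Y\<^sup>*\<close>.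
\<close>

locale complementable_operator = hilbert_space_pair scl\<^sub>1 ip\<^sub>1 scl\<^sub>2 ip\<^sub>2
  for scl\<^sub>1 :: "'k::rc_field \<Rightarrow> 'a::banach \<Rightarrow> 'a" and ip\<^sub>1 :: "'a \<Rightarrow> 'a \<Rightarrow> 'k"
    and scl\<^sub>2 :: "'k \<Rightarrow> 'b::banach \<Rightarrow> 'b" and ip\<^sub>2 :: "'b \<Rightarrow> 'b \<Rightarrow> 'k" +
  fixes M :: "'a set" and N :: "'b set" and T :: "'a \<Rightarrow> 'b" and l :: real and Y :: "'b \<Rightarrow> 'b"
  assumes M: "H1.subspace M" "closed M" and N: "H2.subspace N" "closed N"
    and T: "T \<in> bounded_ops scl\<^sub>1 scl\<^sub>2 UNIV UNIV"
    and pos: "l > 0"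
    and compl: "complementable ip\<^sub>1 ip\<^sub>2 M N l T"
    and Y: "Y \<in> bounded_ops scl\<^sub>2 scl\<^sub>2 (ortho ip\<^sub>2 N) N"
    and Y_adj: "douglas_reduced_solution scl\<^sub>2 scl\<^sub>2 ip\<^sub>2 N (ortho ip\<^sub>2 N)
      (adj ip\<^sub>1 ip\<^sub>2 (ortho ip\<^sub>1 M) N (block ip\<^sub>2 (ortho ip\<^sub>1 M) N T))
      (adj ip\<^sub>1 ip\<^sub>2 (ortho ip\<^sub>1 M) (ortho ip\<^sub>2 N) (block ip\<^sub>2 (ortho ip\<^sub>1 M) (ortho ip\<^sub>2 N) T))
      (adj ip\<^sub>2 ip\<^sub>2 (ortho ip\<^sub>2 N) N Y)"
begin

abbreviation "M' \<equiv> ortho ip\<^sub>1 M"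
abbreviation "N' \<equiv> ortho ip\<^sub>2 N"
abbreviation "A \<equiv> block ip\<^sub>2 M N T"
abbreviation "B \<equiv> block ip\<^sub>2 M' N T"
abbreviation "C \<equiv> block ip\<^sub>2 M N' T"
abbreviation "D \<equiv> block ip\<^sub>2 M' N' T"
abbreviation "Badj \<equiv> adj ip\<^sub>1 ip\<^sub>2 M' N B"
abbreviation "Dadj \<equiv> adj ip\<^sub>1 ip\<^sub>2 M' N' D"
abbreviation "Yadj \<equiv> adj ip\<^sub>2 ip\<^sub>2 N' N Y"
abbreviation "S \<equiv> schur_complement scl\<^sub>1 ip\<^sub>1 ip\<^sub>2 M N T"

lemmas M' = H1.subspace_ortho[of M] H1.closed_ortho[of M]
lemmas N' = H2.subspace_ortho[of N] H2.closed_ortho[of N]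
lemmas blocks = block_bounded_ops[OF T M'(1) N] block_bounded_ops[OF T M(1) N']
  block_bounded_ops[OF T M'(1) N']

sublocale Y: hilbert_space_pair scl\<^sub>2 ip\<^sub>2 scl\<^sub>2 ip\<^sub>2 by unfold_locales

sublocale primal: range_majorization scl\<^sub>1 ip\<^sub>1 scl\<^sub>1 ip\<^sub>1 scl\<^sub>2 ip\<^sub>2 M M' N' C D l
  using M M' blocks pos compl by unfold_locales (auto simp: complementable_def Let_def)

sublocale dual: range_majorization scl\<^sub>2 ip\<^sub>2 scl\<^sub>2 ip\<^sub>2 scl\<^sub>1 ip\<^sub>1 N N' M' Badj Dadj l
  using N N' pos compl adj_bounded_ops[OF blocks(1) M' N(1)] adj_bounded_ops[OF blocks(3) M' N'(1)]
  by unfold_locales (auto simp: complementable_def Let_def)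

text \<open>
  The bound on \<open>Y\<^sup>*\<close>, as a reduced solution, passes to \<open>Y\<close> through
  \<open>\<parallel>Y v\<parallel>\<^sup>2 = \<langle>v, Y\<^sup>* Y v\<rangle> \<le> l \<parallel>v\<parallel> \<parallel>Y v\<parallel>\<close>.
\<close>

lemma norm_Y_le:
  assumes v: "v \<in> N'"
  shows "norm (Y v) \<le> l * norm v"
proof (cases "Y v = 0")
  case False
  have Yv: "Y v \<in> N" by (rule bounded_opsD(1)[OF Y v])
  have "norm (Y v) * norm (Y v) = norm (ip\<^sub>2 v (Yadj (Y v)))"
    by (simp add: H2.ip_self norm_mult power2_eq_square flip: Y.adj_props(2)[OF Y N' Yv v])
  also have "\<dots> \<le> norm v * norm (Yadj (Y v))" by (rule H2.Cauchy_Schwarz)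
  also have "\<dots> \<le> norm v * (l * norm (Y v))"
    using dual.norm_reduced_solution_le[OF Y_adj Yv] by (intro mult_left_mono) auto
  finally show ?thesis using False by (simp add: mult.assoc[symmetric] mult.commute[of l])
qed (use pos in simp)

text \<open>Taking adjoints in \<open>B\<^sup>* = D\<^sup>* Y\<^sup>*\<close>.\<close>

lemma B_eq_YD:
  assumes v: "v \<in> M'"
  shows "B v = Y (D v)"
proof -
  note Dv = bounded_opsD(1)[OF blocks(3) v]
  have "ip\<^sub>2 (B v) n = ip\<^sub>2 (Y (D v)) n" if n: "n \<in> N" for n
  proof -
    have Yn: "Yadj n \<in> N'" by (rule Y.adj_props(1)[OF Y N' n])
    have "Badj n = Dadj (Yadj n)"
      by (rule reduced_solutionD(3)[OF Y_adj n, symmetric])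
    then have "ip\<^sub>2 (B v) n = ip\<^sub>1 v (Dadj (Yadj n))"
      using adj_props(2)[OF blocks(1) M' n v] by simp
    also have "\<dots> = ip\<^sub>2 (D v) (Yadj n)" using adj_props(2)[OF blocks(3) M' Yn v] by simp
    also have "\<dots> = ip\<^sub>2 (Y (D v)) n" using Y.adj_props(2)[OF Y N' n Dv] by simp
    finally show ?thesis .
  qed
  then have "B v - Y (D v) \<in> ortho ip\<^sub>2 N" by (auto simp: ortho_def H2.ip_eq_0_commute H2.ip_diff_left)
  moreover have "B v - Y (D v) \<in> N"
    using bounded_opsD(1)[OF blocks(1) v] bounded_opsD(1)[OF Y Dv] N by (simp add: H2.subspace_diff)
  ultimately show ?thesis using H2.ortho_disjoint by (metis eq_iff_diff_eq_0)
qed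

text \<open>The identity \<open>A - B Z = A - Y C\<close>, which follows from \<open>B Z = Y D Z = Y C\<close>.\<close>

lemma schur_complement_eq:
  "S x = A (proj ip\<^sub>1 M x) - Y (C (proj ip\<^sub>1 M x))"
proof -
  define Z where "Z = (THE Z. douglas_reduced_solution scl\<^sub>1 scl\<^sub>1 ip\<^sub>1 M M' C D Z)"
  have Z: "douglas_reduced_solution scl\<^sub>1 scl\<^sub>1 ip\<^sub>1 M M' C D Z"
    unfolding Z_def by (rule theI'[OF primal.reduced_solution_ex1])
  let ?m = "proj ip\<^sub>1 M x"
  have m: "?m \<in> M" by (rule H1.proj_props(1)[OF M])
  have "B (Z ?m) = Y (D (Z ?m))" by (rule B_eq_YD[OF reduced_solutionD(1)[OF Z m]])
  also have "D (Z ?m) = C ?m" by (rule reduced_solutionD(3)[OF Z m])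
  finally show ?thesis by (simp add: schur_complement_def Let_def Z_def)
qed

lemma schur_complement_proj: "S (proj ip\<^sub>1 M x) = S x"
  using H1.proj_eqI[OF M(1) H1.proj_props(1)[OF M, of x]] H1.subspace_0[OF H1.subspace_ortho]
  by (simp add: schur_complement_eq)

text \<open>
  By \<open>S x = P\<^sub>N T x - Y (1 - P\<^sub>N) T x\<close>, the Schur complement on \<open>M\<close> factors through \<open>T\<close>.
\<close>

lemma norm_schur_complement_le:
  assumes x: "x \<in> M"
  shows "ennreal (norm (S x)) \<le> (1 + op_norm N' Y) * ennreal (norm (T x))"
proof -
  have "proj ip\<^sub>1 M x = x"
    using x by (intro H1.proj_eqI M) (auto simp: H1.subspace_0 H1.subspace_ortho)
  then have "S x = proj ip\<^sub>2 N (T x) - Y (proj ip\<^sub>2 N' (T x))"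
    using x by (simp add: schur_complement_eq block_def)
  then have "norm (S x) \<le> norm (T x) + norm (Y (proj ip\<^sub>2 N' (T x)))"
    using norm_triangle_ineq4 H2.norm_proj_le[OF N, of "T x"]
    by (metis add_right_mono order_trans)
  then have "ennreal (norm (S x)) \<le> ennreal (norm (T x)) + ennreal (norm (Y (proj ip\<^sub>2 N' (T x))))"
    by (simp flip: ennreal_plus)
  also have "ennreal (norm (Y (proj ip\<^sub>2 N' (T x)))) \<le> op_norm N' Y * ennreal (norm (proj ip\<^sub>2 N' (T x)))"
    by (rule op_norm_bound[OF H2.hilbert_space_axioms H2.hilbert_space_axioms Y N'(1)
          H2.proj_props(1)[OF N']])
  also have "\<dots> \<le> op_norm N' Y * ennreal (norm (T x))"
    by (intro mult_left_mono ennreal_leI H2.norm_proj_le[OF N']) simp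
  finally show ?thesis by (simp add: distrib_right add_left_mono)
qed

lemma op_norm_Y_le: "op_norm N' Y \<le> ennreal l"
  unfolding op_norm_def
proof (rule SUP_least)
  fix v assume "v \<in> unit_ball N'"
  then have v: "v \<in> N'" "norm v \<le> 1" by (auto simp: unit_ball_def)
  have "norm (Y v) \<le> l * norm v" by (rule norm_Y_le[OF v(1)])
  also have "\<dots> \<le> l" using v(2) pos by (simp add: mult_left_le)
  finally show "ennreal (norm (Y v)) \<le> ennreal l" by (rule ennreal_leI)
qed

text \<open>
  If \<open>S v = 0\<close>, then \<open>S\<close> also vanishes at the projection of \<open>v\<close> to \<open>M\<close>, which is therefore \<open>0\<close>.
  So the null space of \<open>S\<close> lies in \<open>M\<^sup>\<bottom>\<close>, and the infimum that defines \<open>\<gamma>(S)\<close> takes in all unit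
  vectors of \<open>M\<close>.
\<close>

lemma reduced_min_modulus_schur_le:
  assumes below: "bounded_below_on M S" and x: "x \<in> M" "norm x = 1"
  shows "reduced_min_modulus ip\<^sub>1 S \<le> ennreal (norm (S x))"
  unfolding reduced_min_modulus_def
proof (rule INF_lower, clarsimp simp: x(2))
  obtain c where c: "c > 0" "\<And>x. x \<in> M \<Longrightarrow> norm (S x) \<ge> c * norm x"
    using below by (auto simp: bounded_below_on_def)
  have "ip\<^sub>1 v x = 0" if v: "S v = 0" for v
  proof -
    note p = H1.proj_props[OF M, of v]
    have "c * norm (proj ip\<^sub>1 M v) \<le> 0" using c(2)[OF p(1)] v by (simp add: schur_complement_proj)
    then have "proj ip\<^sub>1 M v = 0" using c(1) by (simp add: mult_le_0_iff)
    then have "v \<in> M'" using p(2) by simp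
    then show ?thesis using x(1) by (auto simp: ortho_def H1.ip_eq_0_commute)
  qed
  then show "x \<in> ortho ip\<^sub>1 {v. S v = 0}" by (simp add: ortho_def)
qed

lemma inj_on_of_schur_bounded_below:
  assumes below: "bounded_below_on M S"
  shows "inj_on T M"
proof (rule inj_onI)
  obtain c where c: "c > 0" "\<And>x. x \<in> M \<Longrightarrow> norm (S x) \<ge> c * norm x"
    using below by (auto simp: bounded_below_on_def)
  fix x y assume xy: "x \<in> M" "y \<in> M" "T x = T y"
  then have d: "x - y \<in> M" using M by (simp add: H1.subspace_diff)
  have "T (x - y) = 0" using xy(3) by (simp add: H1.bounded_ops_diff[OF T H1.subspace_UNIV])
  then have "norm (S (x - y)) \<le> 0" using norm_schur_complement_le[OF d] by simp
  then have "c * norm (x - y) \<le> 0" using c(2)[OF d] by linarith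
  then show "x = y" using c(1) by (simp add: mult_le_0_iff)
qed

lemma modulus_mult_norm_le_norm_T:
  assumes below: "bounded_below_on M S" and x: "x \<in> M"
  shows "reduced_min_modulus ip\<^sub>1 S * ennreal (norm x) \<le> (1 + op_norm N' Y) * ennreal (norm (T x))"
proof (cases "x = 0")
  case False
  let ?g = "reduced_min_modulus ip\<^sub>1 S" and ?r = "1 / norm x"
  have u: "?r *\<^sub>R x \<in> M" using x M by (simp add: H1.subspace_scaleR)
  have Tu: "T (?r *\<^sub>R x) = ?r *\<^sub>R T x"
    by (rule bounded_ops_scaleR[OF H1.hilbert_space_axioms H2.hilbert_space_axioms T]) simp
  have "?g \<le> ennreal (norm (S (?r *\<^sub>R x)))"
    using False by (intro reduced_min_modulus_schur_le[OF below u]) simp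
  also have "\<dots> \<le> (1 + op_norm N' Y) * ennreal (norm (?r *\<^sub>R T x))"
    using norm_schur_complement_le[OF u] by (simp only: Tu)
  finally have "?g * ennreal (norm x)
      \<le> (1 + op_norm N' Y) * ennreal (norm (?r *\<^sub>R T x)) * ennreal (norm x)"
    by (rule mult_right_mono) simp
  also have "\<dots> = (1 + op_norm N' Y) * ennreal (norm (T x))"
    using False by (simp add: mult.assoc flip: ennreal_mult)
  finally show ?thesis .
qed simp

text \<open>
  The values \<open>0\<close> and \<open>\<infinity>\<close> of \<open>\<gamma>(S)\<close> are included: for \<open>0\<close> the quotient is \<open>\<infinity>\<close>, and for \<open>\<infinity>\<close>
  the preceding estimate, whose right-hand side is finite, forces \<open>x = 0\<close>.
\<close>

lemma op_norm_inverse_le: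
  assumes below: "bounded_below_on M S"
  shows "op_norm (T ` M) (inv_into M T) \<le> (1 + op_norm N' Y) / reduced_min_modulus ip\<^sub>1 S"
  unfolding op_norm_def[of "T ` M"]
proof (rule SUP_least)
  let ?g = "reduced_min_modulus ip\<^sub>1 S" and ?k = "1 + op_norm N' Y"
  fix y assume "y \<in> unit_ball (T ` M)"
  then obtain x where x: "x \<in> M" "y = T x" "norm (T x) \<le> 1" by (auto simp: unit_ball_def)
  have inv: "inv_into M T y = x" using inj_on_of_schur_bounded_below[OF below] x by simp
  have k: "op_norm N' Y \<noteq> top" using op_norm_Y_le by (auto simp: top_unique)
  have "?g * ennreal (norm x) \<le> ?k * ennreal (norm (T x))"
    by (rule modulus_mult_norm_le_norm_T[OF below x(1)])
  also have "\<dots> \<le> ?k * 1" using x(3) by (intro mult_left_mono) (simp_all add: ennreal_le_1)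
  finally have le: "?g * ennreal (norm x) \<le> ?k" by simp
  show "ennreal (norm (inv_into M T y)) \<le> ?k / ?g"
  proof (cases "?g = 0 \<or> ?g = top")
    case True
    then show ?thesis using le k by (auto simp: inv ennreal_top_mult top_unique split: if_splits)
  next
    case False
    then have "ennreal (norm x) = ?g * ennreal (norm x) / ?g"
      by (simp add: ennreal_mult_divide_eq mult.commute[of ?g])
    also have "\<dots> \<le> ?k / ?g" by (rule divide_right_mono_ennreal[OF le])
    finally show ?thesis by (simp add: inv)
  qed
qed

end

theorem corollary3p7:
  fixes scl\<^sub>1 :: "'k::rc_field \<Rightarrow> 'a::banach \<Rightarrow> 'a" and ip\<^sub>1 :: "'a \<Rightarrow> 'a \<Rightarrow> 'k"
    and scl\<^sub>2 :: "'k \<Rightarrow> 'b::banach \<Rightarrow> 'b" and ip\<^sub>2 :: "'b \<Rightarrow> 'b \<Rightarrow> 'k"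
    and M M' :: "'a set" and N N' :: "'b set" and T B D S :: "'a \<Rightarrow> 'b" and Y :: "'b \<Rightarrow> 'b"
    and l :: real
  assumes H1: "hilbert_space scl\<^sub>1 ip\<^sub>1" and H2: "hilbert_space scl\<^sub>2 ip\<^sub>2"
    and M: "module.subspace scl\<^sub>1 M" "closed M"
    and N: "module.subspace scl\<^sub>2 N" "closed N"
    and M': "M' = ortho ip\<^sub>1 M" and N': "N' = ortho ip\<^sub>2 N"
    and T: "T \<in> bounded_ops scl\<^sub>1 scl\<^sub>2 UNIV UNIV"
    and B: "B = block ip\<^sub>2 M' N T" and D: "D = block ip\<^sub>2 M' N' T"
    and pos: "l > 0"
    and compl: "complementable ip\<^sub>1 ip\<^sub>2 M N l T"
    and Y: "Y \<in> bounded_ops scl\<^sub>2 scl\<^sub>2 N' N"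
    and Y_adj: "douglas_reduced_solution scl\<^sub>2 scl\<^sub>2 ip\<^sub>2 N N'
      (adj ip\<^sub>1 ip\<^sub>2 M' N B) (adj ip\<^sub>1 ip\<^sub>2 M' N' D) (adj ip\<^sub>2 ip\<^sub>2 N' N Y)"
    and S: "S = schur_complement scl\<^sub>1 ip\<^sub>1 ip\<^sub>2 M N T"
    and below: "bounded_below_on M S"
  shows "inj_on T M \<and>
    op_norm (T ` M) (inv_into M T) \<le> (1 + op_norm N' Y) / reduced_min_modulus ip\<^sub>1 S \<and>
    (1 + op_norm N' Y) / reduced_min_modulus ip\<^sub>1 S \<le> (1 + ennreal l) / reduced_min_modulus ip\<^sub>1 S"
proof -
  note N'_eq = N'
  interpret complementable_operator scl\<^sub>1 ip\<^sub>1 scl\<^sub>2 ip\<^sub>2 M N T l Y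
    using assms
    by (auto simp: complementable_operator_def complementable_operator_axioms_def
        hilbert_space_pair_def)
  note below' = below[unfolded S]
  show ?thesis
    unfolding S N'_eq
    using inj_on_of_schur_bounded_below[OF below'] op_norm_inverse_le[OF below'] op_norm_Y_le
    by (auto intro!: divide_right_mono_ennreal add_left_mono)
qed

end
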